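(* Let $\mu_1,\mu_2,\ldots$ be i.i.d. with prior density $g$ on $(0,\infty)$ satisfying $g(\mu)\sim\alpha\mu^{\beta-1}$ as $\mu\to0$ for some $\alpha>0,\beta>0$, and let $\lambda>0$. Consider idealized empirical CBT: arms $k=1,2,\ldots$ are examined in turn (each revealing its mean $\mu_k$); experimentation stops after $$K=\inf\Big\{k\ge1:\min_{1\le i\le k}\mu_i\le\tfrac{k\lambda}{n}\Big\}$$ arms, after which the arm with the smallest mean $\min_{1\le k\le K}\mu_k$ is played $n$ additional times. Define its regret as $R_n=\lambda EK+nE\big(\min_{1\le k\le K}\mu_k\big)$. Then as $n\to\infty$, $$R_n\sim CI_\beta n^{\frac\beta{\beta+1}},$$ where $C=\big(\frac{\lambda\beta(\beta+1)}{\alpha}\big)^{\frac1{\beta+1}}$ and $I_\beta=\big(\frac1{\beta+1}\big)^{\frac1{\beta+1}}\big(2-\frac1{(\beta+1)^2}\big)\Gamma\big(2-\frac\beta{\beta+1}\big)$, with $\Gamma(u)=\int_0^\infty x^{u-1}e^{-x}dx$.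
   Context: In the paper, $\lambda=\int_0^\infty E_\mu(X\mid X>0)g(\mu)\,d\mu$ is the mean of the first non-zero reward of a random arm, interpreted as the cost of experimenting with a new arm (each arm is played until its first non-zero reward, when its mean is revealed). $a_n\sim b_n$ means $a_n/b_n\to1$. *)

theory Defs
  imports "HOL-Probability.Probability" "HOL-Library.Landau_Symbols"
begin

text \<open>Idealized empirical CBT. Arms are indexed 1,2,...; mu i w is the mean of arm i.
  K = inf {k >= 1 : min_{1<=i<=k} mu_i <= k lam / n}.\<close>

definition cbt_stop :: "real \<Rightarrow> (nat \<Rightarrow> 'a \<Rightarrow> real) \<Rightarrow> nat \<Rightarrow> 'a \<Rightarrow> nat" where
  "cbt_stop lam mu n w =
     (LEAST k. 1 \<le> k \<and> Min ((\<lambda>i. mu i w) ` {1..k}) \<le> real k * lam / real n)"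

definition cbt_best :: "real \<Rightarrow> (nat \<Rightarrow> 'a \<Rightarrow> real) \<Rightarrow> nat \<Rightarrow> 'a \<Rightarrow> real" where
  "cbt_best lam mu n w = Min ((\<lambda>i. mu i w) ` {1..cbt_stop lam mu n w})"

definition cbt_regret :: "'a measure \<Rightarrow> real \<Rightarrow> (nat \<Rightarrow> 'a \<Rightarrow> real) \<Rightarrow> nat \<Rightarrow> real" where
  "cbt_regret M lam mu n =
     lam * (\<integral>w. real (cbt_stop lam mu n w) \<partial>M) + real n * (\<integral>w. cbt_best lam mu n w \<partial>M)"

end

theory Submission
  imports Defs "HOL-Real_Asymp.Real_Asymp"
begin

text \<open>Write \<open>d = \<lambda> / n\<close>, \<open>F\<close> for the distribution function of an arm and
  \<open>G y = E (y - \<mu>)\<^sup>+\<close>. Since the running minimum decreases while the threshold increases,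
  \<open>K > k\<close> holds iff the first \<open>k\<close> arms all exceed \<open>k d\<close>, so \<open>P (K > k) = (1 - F (k d)) ^ k\<close>.
  The best arm \<open>m\<close> satisfies \<open>(K - 1) d \<le> m + ((K - 1) d - \<mu>\<^sub>K)\<^sup>+ \<le> K d\<close>; taking expectations, the
  regret equals \<open>2 \<lambda> E K - n (\<Sum>k. (1 - F (k d)) ^ k * G (k d))\<close> up to an error of at most \<open>\<lambda>\<close>.
  As \<open>F y \<sim> \<alpha> y\<^sup>\<beta> / \<beta>\<close> and \<open>G y \<sim> \<alpha> y\<^bsup>\<beta> + 1\<^esup> / (\<beta> (\<beta> + 1))\<close> near 0, rescaling \<open>k = N u\<close> and dominated
  convergence reduce both sums to integrals of \<open>exp (- u\<^bsup>\<beta> + 1\<^esup>)\<close> and \<open>u\<^bsup>\<beta> + 1\<^esup> exp (- u\<^bsup>\<beta> + 1\<^esup>)\<close>.\<close>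

section \<open>Stopping time and best arm along a path\<close>

text \<open>The threshold grows without bound in \<open>k\<close>, so it eventually passes the mean
  of arm 1 alone. Hence the \<open>LEAST\<close> in \<open>cbt_stop\<close> is attained on every
  path, not just almost surely.\<close>

lemma cbt_stop_exists:
  fixes lam :: real
  assumes "lam > 0" "n > 0"
  shows "\<exists>k\<ge>1. Min ((\<lambda>i. mu i w) ` {1..k}) \<le> real k * lam / real n"
proof -
  define k where "k = max 1 (nat \<lceil>mu 1 w * real n / lam\<rceil>)"
  have "mu 1 w * real n / lam \<le> real k"
    unfolding k_def by linarith
  hence "mu 1 w \<le> real k * lam / real n"
    using assms by (simp add: field_simps)
  moreover have "Min ((\<lambda>i. mu i w) ` {1..k}) \<le> mu 1 w"
    by (intro Min_le) (auto simp: k_def)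
  ultimately have "Min ((\<lambda>i. mu i w) ` {1..k}) \<le> real k * lam / real n"
    by (rule order_trans[rotated])
  moreover have "k \<ge> 1" by (simp add: k_def)
  ultimately show ?thesis by blast
qed

lemma cbt_stop_ge_1:
  assumes "lam > 0" "n > 0"
  shows "1 \<le> cbt_stop lam mu n w"
  unfolding cbt_stop_def using LeastI_ex[OF cbt_stop_exists[OF assms, of mu w]] by blast

lemma cbt_best_le:
  assumes "lam > 0" "n > 0"
  shows "cbt_best lam mu n w \<le> real (cbt_stop lam mu n w) * (lam / real n)"
  unfolding cbt_stop_def cbt_best_def
  using LeastI_ex[OF cbt_stop_exists[OF assms, of mu w]] by simp

text \<open>Stopping at some \<open>K <= k\<close> would put an arm at or below
  \<open>K d <= k d\<close>, so the comparison at stage \<open>k\<close> alone decides whether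
  stopping has occurred. The event thus becomes an intersection of \<open>k\<close> conditions at
  one common level, to which independence applies.\<close>

lemma less_cbt_stop_iff:
  assumes "lam > 0" "n > 0"
  shows "k < cbt_stop lam mu n w \<longleftrightarrow> (\<forall>i\<in>{1..k}. real k * (lam / real n) < mu i w)"
proof
  assume less: "k < cbt_stop lam mu n w"
  show "\<forall>i\<in>{1..k}. real k * (lam / real n) < mu i w"
  proof (cases "k = 0")
    case False
    hence "\<not> Min ((\<lambda>i. mu i w) ` {1..k}) \<le> real k * lam / real n"
      using not_less_Least[OF less[unfolded cbt_stop_def]] by auto
    with False show ?thesis by (simp add: not_le)
  qed simp
next
  assume above: "\<forall>i\<in>{1..k}. real k * (lam / real n) < mu i w"
  show "k < cbt_stop lam mu n w"
  proof (rule ccontr)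
    define K where "K = cbt_stop lam mu n w"
    assume "\<not> k < cbt_stop lam mu n w"
    hence K: "1 \<le> K" "K \<le> k"
      using cbt_stop_ge_1[OF assms] by (auto simp: K_def)
    have "cbt_best lam mu n w \<in> (\<lambda>i. mu i w) ` {1..K}"
      unfolding cbt_best_def K_def[symmetric] using K by (intro Min_in) auto
    then obtain i where "i \<in> {1..K}" "cbt_best lam mu n w = mu i w" by auto
    with above K have "real k * (lam / real n) < cbt_best lam mu n w" by auto
    also have "\<dots> \<le> real K * (lam / real n)"
      unfolding K_def by (rule cbt_best_le[OF assms])
    also have "\<dots> \<le> real k * (lam / real n)"
      using K assms by (intro mult_right_mono) auto
    finally show False by simp
  qed
qed

text \<open>The amount by which the stopping arm falls below the previous threshold. Adding it to
  the best mean fixes the sum up to one threshold step, so the expected best mean can be read off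
  from the expectations of \<open>K\<close> and of this gap.\<close>

definition cbt_gap :: "real \<Rightarrow> (nat \<Rightarrow> 'a \<Rightarrow> real) \<Rightarrow> nat \<Rightarrow> 'a \<Rightarrow> real" where
  "cbt_gap lam mu n w =
     max 0 ((real (cbt_stop lam mu n w) - 1) * (lam / real n) - mu (cbt_stop lam mu n w) w)"

text \<open>All arms before \<open>K\<close> exceed \<open>(K - 1) d\<close>. If the minimum is
  attained at \<open>K\<close>, minimum plus gap is the maximum of \<open>mu K\<close> and
  \<open>(K - 1) d\<close>; otherwise the minimum itself exceeds \<open>(K - 1) d\<close> and the
  gap vanishes. Either value lies within one step of \<open>K d\<close>.\<close>

lemma cbt_best_gap_bounds:
  fixes mu :: "nat \<Rightarrow> 'a \<Rightarrow> real"
  assumes "lam > 0" "n > 0"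
  defines "K \<equiv> \<lambda>w. cbt_stop lam mu n w"
  shows "(real (K w) - 1) * (lam / real n) \<le> cbt_best lam mu n w + cbt_gap lam mu n w"
    and "cbt_best lam mu n w + cbt_gap lam mu n w \<le> real (K w) * (lam / real n)"
proof -
  define d where "d = lam / real n"
  have d: "d > 0" using assms by (simp add: d_def)
  have K1: "1 \<le> K w" unfolding K_def by (rule cbt_stop_ge_1[OF assms(1,2)])
  have before: "(real (K w) - 1) * d < mu i w" if "i \<in> {1..K w - 1}" for i
    using less_cbt_stop_iff[OF assms(1,2), of "K w - 1" mu w] K1 that
    by (auto simp: K_def d_def of_nat_diff)
  have le_last: "cbt_best lam mu n w \<le> mu (K w) w"
    unfolding cbt_best_def K_def[symmetric] using K1 by (intro Min_le) auto
  have "cbt_best lam mu n w \<in> (\<lambda>i. mu i w) ` {1..K w}"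
    unfolding cbt_best_def K_def[symmetric] using K1 by (intro Min_in) auto
  then obtain j where j: "j \<in> {1..K w}" "cbt_best lam mu n w = mu j w" by auto
  have best: "cbt_best lam mu n w \<le> real (K w) * d"
    unfolding K_def d_def by (rule cbt_best_le[OF assms(1,2)])
  have step: "(real (K w) - 1) * d \<le> real (K w) * d" using d by simp
  consider "j = K w" | "(real (K w) - 1) * d < mu j w"
    using before[of j] j(1) by fastforce
  hence "(real (K w) - 1) * d \<le> cbt_best lam mu n w + cbt_gap lam mu n w \<and>
         cbt_best lam mu n w + cbt_gap lam mu n w \<le> real (K w) * d"
    unfolding cbt_gap_def K_def[symmetric] d_def[symmetric]
    using best step le_last j(2) by cases (auto simp: max_def)
  thus "(real (K w) - 1) * (lam / real n) \<le> cbt_best lam mu n w + cbt_gap lam mu n w"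
    and "cbt_best lam mu n w + cbt_gap lam mu n w \<le> real (K w) * (lam / real n)"
    by (auto simp: d_def)
qed

text \<open>Only the summand \<open>k = K - 1\<close> survives: earlier arms exceed even the next, larger threshold.\<close>

lemma cbt_gap_eq_suminf:
  fixes mu :: "nat \<Rightarrow> 'a \<Rightarrow> real"
  assumes "lam > 0" "n > 0"
  shows "ennreal (cbt_gap lam mu n w) =
    (\<Sum>k. (\<Prod>i\<in>{1..k}. indicator {real k * (lam / real n)<..} (mu i w)) *
          ennreal (max 0 (real k * (lam / real n) - mu (Suc k) w)))"
proof -
  define d where "d = lam / real n"
  have d: "d > 0" using assms by (simp add: d_def)
  define K where "K = cbt_stop lam mu n w"
  have K1: "1 \<le> K" unfolding K_def by (rule cbt_stop_ge_1[OF assms(1,2)])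
  have less_iff: "k < K \<longleftrightarrow> (\<forall>i\<in>{1..k}. real k * d < mu i w)" for k
    unfolding K_def d_def by (rule less_cbt_stop_iff[OF assms])
  have prod: "(\<Prod>i\<in>{1..k}. indicator {real k * d<..} (mu i w) :: ennreal) = (if k < K then 1 else 0)" for k
    unfolding less_iff by (auto intro!: prod.neutral simp: indicator_def)
  have zero: "(if k < K then 1 else 0) * ennreal (max 0 (real k * d - mu (Suc k) w)) = 0"
    if "k \<notin> {K - 1}" for k
  proof (cases "Suc k < K")
    case True
    hence "real (Suc k) * d < mu (Suc k) w" using less_iff[of "Suc k"] by auto
    moreover have "real k * d \<le> real (Suc k) * d" using d by simp
    ultimately have "real k * d - mu (Suc k) w \<le> 0" by linarith
    thus ?thesis by (simp add: max_def)
  qed (use that in auto)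
  have "(\<Sum>k. (if k < K then 1 else 0) * ennreal (max 0 (real k * d - mu (Suc k) w))) =
        (\<Sum>k\<in>{K - 1}. (if k < K then 1 else 0) * ennreal (max 0 (real k * d - mu (Suc k) w)))"
    by (rule suminf_finite) (use zero in auto)
  also have "\<dots> = ennreal (cbt_gap lam mu n w)"
    using K1 by (simp add: cbt_gap_def K_def[symmetric] d_def[symmetric] of_nat_diff)
  finally show ?thesis
    unfolding d_def[symmetric] prod by simp
qed

section \<open>Scaling limit of survival sums\<close>

text \<open>Substitute \<open>t = u powr p\<close> in Euler's integral at
  \<open>s = (q + 1) / p\<close>. With \<open>p = \<beta> + 1\<close> this evaluates the limits
  below; with \<open>p = 1\<close> it shows that the dominating function is integrable.\<close>

lemma has_bochner_integral_powr_exp_powr: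
  fixes p q :: real
  assumes p: "p > 0" and q: "q > -1"
  shows "has_bochner_integral lborel (\<lambda>u. indicator {0<..} u * (u powr q * exp (- (u powr p))))
           (Gamma ((q + 1) / p) / p)"
proof -
  define s where "s = (q + 1) / p"
  have s: "s > 0" using p q by (simp add: s_def)
  define f where "f = (\<lambda>t::real. t powr (s - 1) / exp t)"
  define h where "h = (\<lambda>u::real. u powr p)"
  have "(f has_integral Gamma s) {0..}"
    unfolding f_def by (rule Gamma_integral_real[OF s])
  \<comment> \<open>The endpoint is dropped because the substitution is a differentiable bijection
    of the open half-line.\<close>
  hence f_int: "(f has_integral Gamma s) {0<..}"
    by (rule has_integral_spike_set_eq[THEN iffD1, rotated -1]) (auto intro: negligible_subset[of "{0}"])
  hence "f absolutely_integrable_on {0<..}"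
    by (intro nonnegative_absolutely_integrable_1) (auto simp: f_def has_integral_iff)
  moreover have image: "h ` {0<..} = {0<..}"
  proof (intro equalityI subsetI)
    fix t :: real assume t: "t \<in> {0<..}"
    have "t = h (t powr (1 / p))" using t p by (simp add: h_def powr_powr)
    thus "t \<in> h ` {0<..}" using t by auto
  qed (auto simp: h_def)
  ultimately have "f absolutely_integrable_on (h ` {0<..}) \<and> integral (h ` {0<..}) f = Gamma s"
    using f_int by (simp add: has_integral_iff)
  moreover have "(h has_field_derivative p * u powr (p - 1)) (at u within {0<..})" if "u \<in> {0<..}" for u
    using that unfolding h_def by (auto intro!: derivative_eq_intros)
  moreover have "inj_on h {0<..}"
    unfolding h_def using p by (intro inj_onI) (metis greaterThan_iff less_imp_le powr_less_mono2 less_irrefl linorder_neqE)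
  ultimately have "(\<lambda>u. \<bar>p * u powr (p - 1)\<bar> * f (h u)) absolutely_integrable_on {0<..} \<and>
                   integral {0<..} (\<lambda>u. \<bar>p * u powr (p - 1)\<bar> * f (h u)) = Gamma s"
    by (subst has_absolute_integral_change_of_variables_1') auto
  hence "((\<lambda>u. \<bar>p * u powr (p - 1)\<bar> * f (h u)) has_integral Gamma s) {0<..}"
    by (auto simp: has_integral_iff absolutely_integrable_on_def)
  hence "((\<lambda>u. \<bar>p * u powr (p - 1)\<bar> * f (h u) / p) has_integral Gamma s / p) {0<..}"
    by (rule has_integral_divide)
  moreover have "\<bar>p * u powr (p - 1)\<bar> * f (h u) / p = u powr q * exp (- (u powr p))" if "u \<in> {0<..}" for u
    using that p by (simp add: f_def h_def s_def powr_powr exp_minus field_simps flip: powr_add)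
  ultimately have "((\<lambda>u. u powr q * exp (- (u powr p))) has_integral Gamma s / p) {0<..}"
    by (rule has_integral_eq[rotated])
  hence "(\<integral>\<^sup>+u. ennreal (indicator {0<..} u * (u powr q * exp (- (u powr p)))) \<partial>lborel) = ennreal (Gamma s / p)"
    by (intro nn_integral_has_integral_lebesgue) auto
  thus ?thesis
    unfolding s_def[symmetric] using s p
    by (intro has_bochner_integral_nn_integral) (auto intro!: divide_nonneg_pos Gamma_real_nonneg)
qed

text \<open>A series is the integral of its step function over the half-line; the substitution
  \<open>t = N u\<close> then puts every series on the same rescaled axis, where dominated
  convergence applies.\<close>

lemma suminf_ennreal_eq_nn_integral:
  fixes a :: "nat \<Rightarrow> ennreal" and N :: real
  assumes N: "N > 0"
  shows "(\<Sum>k. a k) = ennreal N * (\<integral>\<^sup>+u. a (nat \<lfloor>N * u\<rfloor>) * indicator {0<..} u \<partial>lborel)"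
proof -
  have "(\<Sum>k. a k) = (\<Sum>k. \<integral>\<^sup>+t. a k * indicator {real k..<real k + 1} t \<partial>lborel)"
    by (simp add: nn_integral_cmult_indicator)
  also have "\<dots> = (\<integral>\<^sup>+t. (\<Sum>k. a k * indicator {real k..<real k + 1} t) \<partial>lborel)"
    by (rule nn_integral_suminf[symmetric]) simp
  also have "\<dots> = (\<integral>\<^sup>+t. a (nat \<lfloor>t::real\<rfloor>) * indicator {0<..} t \<partial>lborel)"
  proof (intro nn_integral_cong_AE)
    \<comment> \<open>Only the null set \<open>t = 0\<close> is exceptional: it belongs to the first
      step interval but not to \<open>{0<..}\<close>. For negative \<open>t\<close> both sides are
      0.\<close>
    have *: "(\<Sum>k. a k * indicator {real k..<real k + 1} t) = a (nat \<lfloor>t\<rfloor>) * indicator {0<..} t"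
      if "t \<noteq> 0" for t :: real
    proof -
      have "(\<Sum>k. a k * indicator {real k..<real k + 1} t) =
            (\<Sum>k\<in>{nat \<lfloor>t\<rfloor>}. a k * indicator {real k..<real k + 1} t)"
      proof (rule suminf_finite)
        fix k assume k: "k \<notin> {nat \<lfloor>t\<rfloor>}"
        have "\<not> (real k \<le> t \<and> t < real k + 1)"
        proof
          assume "real k \<le> t \<and> t < real k + 1"
          hence "\<lfloor>t\<rfloor> = int k" by (intro floor_unique) auto
          with k show False by simp
        qed
        thus "a k * indicator {real k..<real k + 1} t = 0" by (auto simp: indicator_def)
      qed simp
      also have "\<dots> = a (nat \<lfloor>t\<rfloor>) * indicator {0<..} t"
      proof (cases "t > 0")
        case True
        hence "real (nat \<lfloor>t\<rfloor>) \<le> t \<and> t < real (nat \<lfloor>t\<rfloor>) + 1" by linarith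
        with True show ?thesis by simp
      qed (use that in simp)
      finally show ?thesis .
    qed
    thus "AE t in lborel. (\<Sum>k. a k * indicator {real k..<real k + 1} t) = a (nat \<lfloor>t\<rfloor>) * indicator {0<..} t"
      using * by (intro eventually_mono[OF AE_lborel_singleton[of 0]])
  qed
  also have "\<dots> = ennreal \<bar>N\<bar> * (\<integral>\<^sup>+u. a (nat \<lfloor>0 + N * u\<rfloor>) * indicator {0<..} (0 + N * u) \<partial>lborel)"
    by (subst nn_integral_real_affine[of _ N 0]) (use N in auto)
  also have "(\<lambda>u. a (nat \<lfloor>0 + N * u\<rfloor>) * indicator {0<..} (0 + N * u)) =
             (\<lambda>u. a (nat \<lfloor>N * u\<rfloor>) * indicator {0<..} u)"
    using N by (auto simp: indicator_def zero_less_mult_iff)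
  finally show ?thesis using N by simp
qed

text \<open>\<open>N n\<close> is the natural scale of the stopping time: \<open>N powr (\<beta> + 1) * \<kappa> * d powr \<beta> = 1\<close>,
  which is where the exponent \<open>k * F (k * d)\<close> becomes of order one for \<open>k \<approx> N\<close>.\<close>

locale cdf_scaling =
  fixes F :: "real \<Rightarrow> real" and \<beta> \<kappa> :: real and d :: "nat \<Rightarrow> real"
  assumes F_mono: "mono F" and F_nonneg: "\<And>x. 0 \<le> F x" and F_le_1: "\<And>x. F x \<le> 1"
    and beta: "\<beta> > 0" and kappa: "\<kappa> > 0"
    and F_ratio: "((\<lambda>x. F x / x powr \<beta>) \<longlongrightarrow> \<kappa>) (at_right 0)"
    and d_pos: "\<And>n. d n > 0" and d_lim: "d \<longlonglongrightarrow> 0"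
begin

definition N :: "nat \<Rightarrow> real" where "N n = (\<kappa> * d n powr \<beta>) powr (- 1 / (\<beta> + 1))"

text \<open>The stage reached at rescaled time \<open>u\<close>, in the form produced by
  \<open>suminf_ennreal_eq_nn_integral\<close>.\<close>

definition idx :: "nat \<Rightarrow> real \<Rightarrow> nat" where "idx n u = nat \<lfloor>N n * u\<rfloor>"

lemma d_at_right: "filterlim d (at_right 0) sequentially"
  using d_lim d_pos by (auto simp: filterlim_at less_imp_neq[symmetric])

lemma N_pos [simp]: "N n > 0"
  unfolding N_def using kappa d_pos[of n] by simp

lemma N_nonneg [simp]: "0 \<le> N n" and N_neq_0 [simp]: "N n \<noteq> 0"
  using N_pos[of n] by linarith+

lemma N_powr: "N n powr (\<beta> + 1) * d n powr \<beta> = 1 / \<kappa>"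
proof -
  have "N n powr (\<beta> + 1) = (\<kappa> * d n powr \<beta>) powr (-1)"
    unfolding N_def using beta by (simp add: powr_powr)
  also have "\<dots> = 1 / (\<kappa> * d n powr \<beta>)"
    using kappa by (simp add: powr_minus_divide)
  finally show ?thesis using d_pos[of n] by simp
qed

lemma N_at_top: "filterlim N at_top sequentially"
proof -
  have "filterlim (\<lambda>x. (\<kappa> * x powr \<beta>) powr (- 1 / (\<beta> + 1))) at_top (at_right 0)"
    using kappa beta by real_asymp
  from filterlim_compose[OF this d_at_right] show ?thesis by (simp add: N_def[abs_def])
qed

text \<open>Up to a constant the product is \<open>d powr (1 / (\<beta> + 1))\<close>. So thresholds
  \<open>k d\<close> at stages \<open>k\<close> of order \<open>N\<close> shrink to 0, and the limit
  sees \<open>F\<close> only near 0.\<close>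

lemma N_d_lim: "(\<lambda>n. N n * d n) \<longlonglongrightarrow> 0"
proof -
  have "((\<lambda>x. (\<kappa> * x powr \<beta>) powr (- 1 / (\<beta> + 1)) * x) \<longlongrightarrow> 0) (at_right 0)"
    using kappa beta by real_asymp
  from filterlim_compose[OF this d_at_right] show ?thesis by (simp add: N_def[abs_def])
qed

lemma idx_bounds:
  assumes u: "u > 0"
  shows "N n * u - 1 \<le> real (idx n u)" "u - 1 / N n \<le> real (idx n u) / N n" "real (idx n u) / N n \<le> u"
proof -
  have "N n * u \<ge> 0" using u by simp
  hence *: "real (idx n u) \<le> N n * u" "N n * u - 1 \<le> real (idx n u)"
    unfolding idx_def by linarith+
  show "N n * u - 1 \<le> real (idx n u)" by fact
  show "real (idx n u) / N n \<le> u" using *(1) N_pos[of n] by (simp add: pos_divide_le_eq mult.commute)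
  have "u - 1 / N n = (N n * u - 1) / N n" by (simp add: diff_divide_distrib)
  also have "\<dots> \<le> real (idx n u) / N n" using *(2) by (intro divide_right_mono) auto
  finally show "u - 1 / N n \<le> real (idx n u) / N n" .
qed

lemma idx_lim:
  assumes u: "u > 0"
  shows idx_div_N: "(\<lambda>n. real (idx n u) / N n) \<longlonglongrightarrow> u"
    and idx_d_at_right: "filterlim (\<lambda>n. real (idx n u) * d n) (at_right 0) sequentially"
proof -
  show *: "(\<lambda>n. real (idx n u) / N n) \<longlonglongrightarrow> u"
  proof (rule tendsto_sandwich)
    show "(\<lambda>n. u - 1 / N n) \<longlonglongrightarrow> u"
      using tendsto_diff[OF tendsto_const tendsto_divide_0[OF tendsto_const filterlim_at_top_imp_at_infinity[OF N_at_top]]]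
      by simp
    show "\<forall>\<^sub>F n in sequentially. u - 1 / N n \<le> real (idx n u) / N n"
      using idx_bounds(2)[OF u] by (auto intro!: always_eventually)
    show "\<forall>\<^sub>F n in sequentially. real (idx n u) / N n \<le> u"
      using idx_bounds(3)[OF u] by (auto intro!: always_eventually)
  qed auto
  have "\<forall>\<^sub>F n in sequentially. real (idx n u) / N n > 0"
    using order_tendstoD(1)[OF *, of 0] u by simp
  hence "\<forall>\<^sub>F n in sequentially. real (idx n u) * d n > 0"
    by eventually_elim (use d_pos N_pos in \<open>auto simp: zero_less_divide_iff\<close>)
  moreover have "(\<lambda>n. real (idx n u) / N n * (N n * d n)) \<longlonglongrightarrow> u * 0"
    by (intro tendsto_mult * N_d_lim)
  hence "(\<lambda>n. real (idx n u) * d n) \<longlonglongrightarrow> 0"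
    by simp
  ultimately show "filterlim (\<lambda>n. real (idx n u) * d n) (at_right 0) sequentially"
    unfolding filterlim_at by (auto elim!: eventually_mono intro: gr0I)
qed

text \<open>This is where the choice of \<open>N\<close> pays off: since \<open>F x\<close> is close
  to \<open>\<kappa> * x powr \<beta>\<close>, the exponent \<open>k * F (k * d)\<close> is close to
  \<open>(k / N) powr (\<beta> + 1)\<close>, a function of rescaled time alone.\<close>

lemma scaled_powr:
  "real k * (real k * d n) powr \<beta> = (real k / N n) powr (\<beta> + 1) / \<kappa>"
proof (cases "k = 0")
  case False
  hence "real k * (real k * d n) powr \<beta> = real k powr (\<beta> + 1) * d n powr \<beta>"
    using d_pos[of n] by (simp add: powr_mult powr_add)
  also have "\<dots> = (real k / N n) powr (\<beta> + 1) * (N n powr (\<beta> + 1) * d n powr \<beta>)"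
    using N_pos[of n] by (simp add: powr_divide)
  finally show ?thesis by (simp only: N_powr) simp
qed (use beta in auto)

text \<open>The power is squeezed between \<open>exp (- k F - 2 k F^2)\<close> and
  \<open>exp (- k F)\<close>. By \<open>scaled_powr\<close>, \<open>k F\<close> tends to
  \<open>u powr (\<beta> + 1)\<close>, while \<open>F\<close> tends to 0 and removes the quadratic
  term.\<close>

lemma survival_lim:
  assumes u: "u > 0"
  shows "(\<lambda>n. (1 - F (real (idx n u) * d n)) ^ idx n u) \<longlonglongrightarrow> exp (- (u powr (\<beta> + 1)))"
proof -
  define x where "x n = real (idx n u) * d n" for n
  have x: "filterlim x (at_right 0) sequentially"
    unfolding x_def[abs_def] by (rule idx_d_at_right[OF u])
  have ratio: "(\<lambda>n. F (x n) / x n powr \<beta>) \<longlonglongrightarrow> \<kappa>"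
    by (rule filterlim_compose[OF F_ratio x])
  have x_pos: "\<forall>\<^sub>F n in sequentially. x n > 0"
    using x by (auto simp: filterlim_at elim: eventually_mono)
  have "(\<lambda>n. (real (idx n u) / N n) powr (\<beta> + 1) / \<kappa> * (F (x n) / x n powr \<beta>)) \<longlonglongrightarrow>
        u powr (\<beta> + 1) / \<kappa> * \<kappa>"
    using u beta kappa by (intro tendsto_mult tendsto_divide tendsto_powr idx_div_N ratio tendsto_const) auto
  moreover have "\<forall>\<^sub>F n in sequentially. (real (idx n u) / N n) powr (\<beta> + 1) / \<kappa> * (F (x n) / x n powr \<beta>) =
      real (idx n u) * F (x n)"
    using x_pos by eventually_elim (auto simp: scaled_powr[symmetric] x_def)
  ultimately have kF: "(\<lambda>n. real (idx n u) * F (x n)) \<longlonglongrightarrow> u powr (\<beta> + 1)"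
    using kappa by (simp add: filterlim_cong)
  have "(\<lambda>n. F (x n) / x n powr \<beta> * x n powr \<beta>) \<longlonglongrightarrow> \<kappa> * 0 powr \<beta>"
    using x beta x_pos
    by (intro tendsto_mult ratio tendsto_powr') (auto simp: filterlim_at elim!: eventually_mono)
  moreover have "\<forall>\<^sub>F n in sequentially. F (x n) / x n powr \<beta> * x n powr \<beta> = F (x n)"
    using x_pos by eventually_elim simp
  ultimately have F0: "(\<lambda>n. F (x n)) \<longlonglongrightarrow> 0"
    using beta by (simp add: filterlim_cong)
  show ?thesis
    unfolding x_def[symmetric]
  proof (rule tendsto_sandwich)
    \<comment> \<open>The lower bound \<open>- x - 2 x^2\<close> for \<open>ln (1 - x)\<close> is
      available on \<open>[0, 1/2]\<close>.\<close>
    have "\<forall>\<^sub>F n in sequentially. F (x n) < 1/2"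
      using order_tendstoD(2)[OF F0, of "1/2"] by simp
    thus "\<forall>\<^sub>F n in sequentially. exp (- (real (idx n u) * F (x n)) - 2 * (real (idx n u) * F (x n)) * F (x n))
            \<le> (1 - F (x n)) ^ idx n u"
    proof eventually_elim
      case (elim n)
      have "exp (- (real (idx n u) * F (x n)) - 2 * (real (idx n u) * F (x n)) * F (x n)) =
            exp (real (idx n u) * (- F (x n) - 2 * (F (x n))\<^sup>2))"
        by (simp add: algebra_simps power2_eq_square)
      also have "\<dots> \<le> exp (real (idx n u) * ln (1 - F (x n)))"
        using elim F_nonneg ln_one_minus_pos_lower_bound[of "F (x n)"] by (auto intro!: mult_left_mono)
      also have "\<dots> = (1 - F (x n)) ^ idx n u"
        using elim by (simp add: exp_of_nat_mult)
      finally show ?case .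
    qed
    show "\<forall>\<^sub>F n in sequentially. (1 - F (x n)) ^ idx n u \<le> exp (- (real (idx n u) * F (x n)))"
    proof (intro always_eventually allI)
      fix n
      have "(1 - F (x n)) ^ idx n u \<le> exp (- F (x n)) ^ idx n u"
        using F_le_1[of "x n"] exp_ge_add_one_self[of "- F (x n)"] by (intro power_mono) auto
      thus "(1 - F (x n)) ^ idx n u \<le> exp (- (real (idx n u) * F (x n)))"
        by (simp add: exp_of_nat_mult[symmetric])
    qed
    have "(\<lambda>n. - (real (idx n u) * F (x n)) - 2 * (real (idx n u) * F (x n)) * F (x n)) \<longlonglongrightarrow>
       - (u powr (\<beta> + 1)) - 2 * (u powr (\<beta> + 1)) * 0"
      by (intro tendsto_intros kF F0)
    from tendsto_exp[OF this]
    show "(\<lambda>n. exp (- (real (idx n u) * F (x n)) - 2 * (real (idx n u) * F (x n)) * F (x n)))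
       \<longlonglongrightarrow> exp (- (u powr (\<beta> + 1)))" by simp
    show "(\<lambda>n. exp (- (real (idx n u) * F (x n)))) \<longlonglongrightarrow> exp (- (u powr (\<beta> + 1)))"
      by (intro tendsto_intros kF)
  qed
qed

text \<open>Supplies the majorant for dominated convergence. The power law controls \<open>F\<close>
  only near 0, so the decay is weakened to a plain exponential, which also holds for large
  thresholds, where monotonicity just keeps \<open>F\<close> away from 0.\<close>

lemma survival_bound:
  obtains D a where "D > 0" "a > 0"
    "\<forall>\<^sub>F n in sequentially. \<forall>u>0. (1 - F (real (idx n u) * d n)) ^ idx n u \<le> D * exp (- (a * u))"
proof -
  have "\<forall>\<^sub>F x in at_right 0. F x / x powr \<beta> > \<kappa> / 2"
    using order_tendstoD(1)[OF F_ratio, of "\<kappa> / 2"] kappa by simp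
  then obtain b where b: "b > 0" "\<And>x. 0 < x \<Longrightarrow> x < b \<Longrightarrow> F x / x powr \<beta> > \<kappa> / 2"
    by (auto simp: eventually_at_right_field)
  \<comment> \<open>Halving \<open>b\<close> makes the lower bound valid at \<open>x0\<close>
    itself, which yields \<open>q > 0\<close>.\<close>
  define x0 where "x0 = b / 2"
  have x0: "x0 > 0" using b by (simp add: x0_def)
  have F_ge: "F x \<ge> \<kappa> / 2 * x powr \<beta>" if "0 < x" "x \<le> x0" for x
    using b(2)[of x] that b(1) by (simp add: x0_def field_simps)
  define q where "q = F x0"
  have q: "q > 0"
    unfolding q_def using x0 kappa by (intro less_le_trans[OF _ F_ge[of x0]]) auto
  \<comment> \<open>The rate \<open>1/2\<close> comes from thresholds up to \<open>x0\<close> and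
    the rate \<open>q\<close> from those beyond. The additive losses in the two regimes are at most
    1 and \<open>q\<close>, whence the factor \<open>exp (1 + q)\<close>.\<close>
  define a where "a = min (1/2) q"
  have a: "a > 0" "a \<le> 1/2" "a \<le> q" using q by (auto simp: a_def)
  show ?thesis
  proof (rule that[of "exp (1 + q)" a])
    have "\<forall>\<^sub>F n in sequentially. N n \<ge> 1"
      using N_at_top unfolding filterlim_at_top by blast
    thus "\<forall>\<^sub>F n in sequentially. \<forall>u>0. (1 - F (real (idx n u) * d n)) ^ idx n u \<le> exp (1 + q) * exp (- (a * u))"
    proof (eventually_elim, intro allI impI)
      fix n and u :: real assume N1: "N n \<ge> 1" and u: "u > 0"
      define k where "k = idx n u"
      define x where "x = real k * d n"
      have k: "N n * u - 1 \<le> real k" "u - 1 / N n \<le> real k / N n"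
        unfolding k_def using idx_bounds(1,2)[OF u] by auto
      have Nu: "u \<le> N n * u" using N1 u by simp
      have *: "- (real k * F x) \<le> 1 + q - a * u"
      proof -
        \<comment> \<open>If \<open>k = 0\<close> then \<open>u <= 1\<close> and the constant
          suffices. Up to \<open>x0\<close> the power law gives
          \<open>k F >= v powr (\<beta> + 1) / 2\<close> with \<open>v = k / N\<close>; beyond
          \<open>x0\<close>, \<open>k F >= k q\<close>.\<close>
        consider "k = 0" | "k > 0" "x \<le> x0" | "x > x0" by fastforce
        thus ?thesis
        proof cases
          assume "k = 0"
          hence "u \<le> 1" using k Nu by simp
          hence "a * u \<le> 1 / 2 * 1" using a u by (intro mult_mono) auto
          thus ?thesis using \<open>k = 0\<close> q by simp
        next
          assume x: "k > 0" "x \<le> x0"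
          define v where "v = real k / N n"
          have v: "v > 0" "u - 1 \<le> v"
          proof -
            show "v > 0" using x by (simp add: v_def)
            have "u - 1 \<le> u - 1 / N n" using N1 by simp
            also have "\<dots> \<le> v" using k(2) by (simp add: v_def)
            finally show "u - 1 \<le> v" .
          qed
          have "v - 1 \<le> v powr (\<beta> + 1)"
          proof (cases "v \<ge> 1")
            case True
            hence "v powr 1 \<le> v powr (\<beta> + 1)" using beta by (intro powr_mono) auto
            thus ?thesis using True by simp
          next
            case False
            have "0 \<le> v powr (\<beta> + 1)" by simp
            with False show ?thesis by linarith
          qed
          hence "(u - 2) / 2 \<le> v powr (\<beta> + 1) / \<kappa> * (\<kappa> / 2)"
            using v kappa by simp
          also have "\<dots> = real k * (\<kappa> / 2 * x powr \<beta>)"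
            unfolding v_def x_def scaled_powr[symmetric] by simp
          also have "\<dots> \<le> real k * F x"
            using x d_pos[of n] by (intro mult_left_mono F_ge) (auto simp: x_def)
          finally have "u / 2 - 1 \<le> real k * F x" by simp
          moreover have "a * u \<le> 1/2 * u" using a u by (intro mult_right_mono) auto
          ultimately show ?thesis using q by simp
        next
          assume "x > x0"
          hence "q \<le> F x" unfolding q_def using F_mono by (simp add: mono_def)
          hence "real k * q \<le> real k * F x" by (intro mult_left_mono) auto
          moreover have "(u - 1) * q \<le> real k * q"
            using k Nu q by (intro mult_right_mono) auto
          moreover have "a * u \<le> q * u" using a u by (intro mult_right_mono) auto
          ultimately show ?thesis by (simp add: algebra_simps)
        qed
      qed
      have "(1 - F x) ^ k \<le> exp (- F x) ^ k"
        using F_le_1[of x] exp_ge_add_one_self[of "- F x"] by (intro power_mono) auto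
      also have "\<dots> = exp (- (real k * F x))" by (simp add: exp_of_nat_mult[symmetric])
      also have "\<dots> \<le> exp (1 + q - a * u)" using * by simp
      finally show "(1 - F (real (idx n u) * d n)) ^ idx n u \<le> exp (1 + q) * exp (- (a * u))"
        by (simp add: k_def x_def exp_diff exp_minus field_simps)
    qed
  qed (use a in auto)
qed

text \<open>Dominated convergence on the rescaled axis. Weight 1 will give the expectation of
  \<open>K\<close>, and weight \<open>G (k d) / d\<close> that of the gap. Stating the equality in
  \<open>ennreal\<close> delivers finiteness of these expectations as well.\<close>

lemma weighted_survival_sum:
  assumes w_nonneg: "\<And>n k. 0 \<le> w n k"
    and w_bound: "\<And>n k. w n k \<le> B * (1 + (real k / N n) powr (\<beta> + 1))"
    and w_lim: "\<And>u. u > 0 \<Longrightarrow> (\<lambda>n. w n (idx n u)) \<longlonglongrightarrow> c * u powr q"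
    and q: "q > -1"
  obtains h where "h \<longlonglongrightarrow> c * Gamma ((q + 1) / (\<beta> + 1)) / (\<beta> + 1)" "\<And>n. h n \<ge> 0"
    "\<forall>\<^sub>F n in sequentially. (\<Sum>k. ennreal ((1 - F (real k * d n)) ^ k * w n k)) = ennreal (N n * h n)"
proof -
  define p where "p = \<beta> + 1"
  have p: "p > 0" using beta by (simp add: p_def)
  obtain D a where D: "D > 0" "a > 0" and
    "\<forall>\<^sub>F n in sequentially. \<forall>u>0. (1 - F (real (idx n u) * d n)) ^ idx n u \<le> D * exp (- (a * u))"
    by (rule survival_bound)
  then obtain n0 where n0:
    "\<And>n u. n \<ge> n0 \<Longrightarrow> u > 0 \<Longrightarrow> (1 - F (real (idx n u) * d n)) ^ idx n u \<le> D * exp (- (a * u))"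
    by (auto simp: eventually_sequentially)
  define f where "f = (\<lambda>n u. indicator {0<..} u * ((1 - F (real (idx n u) * d n)) ^ idx n u * w n (idx n u)))"
  define g where "g = (\<lambda>u. indicator {0<..} u * (D * exp (- (a * u)) * (B * (1 + u powr p))))"
  have B: "B \<ge> 0"
    using order_trans[OF w_nonneg w_bound, of 0 0] p by (simp add: p_def)
  have meas [measurable]: "f n \<in> borel_measurable borel" for n
  proof -
    have "(\<lambda>u. idx n u) \<in> borel \<rightarrow>\<^sub>M count_space UNIV" unfolding idx_def by measurable
    hence "(\<lambda>u. (1 - F (real (idx n u) * d n)) ^ idx n u * w n (idx n u)) \<in> borel_measurable borel"
      by (rule measurable_compose) simp
    thus ?thesis unfolding f_def by measurable
  qed
  have f_nonneg: "f n u \<ge> 0" for n u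
    unfolding f_def using F_le_1 w_nonneg by (auto simp: indicator_def)
  \<comment> \<open>Rescale the Gamma integrand by \<open>a\<close>; the moments
    \<open>r = 0\<close> and \<open>r = p\<close> make \<open>g\<close> integrable.\<close>
  have moment: "integrable lborel (\<lambda>u. indicator {0<..} u * (u powr r * exp (- (a * u))))" if "r > -1" for r
  proof -
    have "integrable lborel (\<lambda>u. indicator {0<..} u * (u powr r * exp (- (u powr 1))))"
      using has_bochner_integral_powr_exp_powr[of 1 r] that by (auto simp: has_bochner_integral_iff)
    from lborel_integrable_real_affine[OF this, of a 0] D(2)
    have "integrable lborel (\<lambda>u. a powr (- r) * (indicator {0<..} (a * u) * ((a * u) powr r * exp (- ((a * u) powr 1)))))"
      by simp
    also have "(\<lambda>u. a powr (- r) * (indicator {0<..} (a * u) * ((a * u) powr r * exp (- ((a * u) powr 1))))) =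
               (\<lambda>u. indicator {0<..} u * (u powr r * exp (- (a * u))))"
      using D(2) by (auto simp: fun_eq_iff indicator_def powr_mult powr_minus zero_less_mult_iff)
    finally show ?thesis .
  qed
  have "integrable lborel (\<lambda>u. D * B * (indicator {0<..} u * (u powr 0 * exp (- (a * u)))) +
          D * B * (indicator {0<..} u * (u powr p * exp (- (a * u)))))"
    using p by (intro Bochner_Integration.integrable_add integrable_mult_right moment) auto
  also have "(\<lambda>u. D * B * (indicator {0<..} u * (u powr 0 * exp (- (a * u)))) +
          D * B * (indicator {0<..} u * (u powr p * exp (- (a * u))))) = g"
    by (auto simp: g_def fun_eq_iff indicator_def algebra_simps)
  finally have g: "integrable lborel g" .
  have f_le: "f n u \<le> g u" if "n \<ge> n0" for n u
  proof (cases "u > 0")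
    case True
    have "real (idx n u) / N n \<le> u"
      by (rule idx_bounds(3)[OF True])
    hence "(real (idx n u) / N n) powr p \<le> u powr p"
      using p N_pos[of n] by (intro powr_mono2) auto
    hence "w n (idx n u) \<le> B * (1 + u powr p)"
      using w_bound[of n "idx n u"] B unfolding p_def[symmetric]
      by (meson add_left_mono mult_left_mono order_trans)
    thus ?thesis
      unfolding f_def g_def using True n0[OF that True] w_nonneg D(1) F_le_1
      by (auto intro!: mult_mono)
  qed (auto simp: f_def g_def)
  have f_lim: "(\<lambda>n. f n u) \<longlonglongrightarrow> c * (indicator {0<..} u * (u powr q * exp (- (u powr p))))" for u
  proof (cases "u > 0")
    case True
    have "(\<lambda>n. (1 - F (real (idx n u) * d n)) ^ idx n u * w n (idx n u)) \<longlonglongrightarrow> exp (- (u powr p)) * (c * u powr q)"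
      unfolding p_def by (intro tendsto_mult survival_lim w_lim True)
    with True show ?thesis by (simp add: f_def mult_ac)
  qed (simp add: f_def)
  have f_int: "integrable lborel (f n)" if "n \<ge> n0" for n
    by (rule Bochner_Integration.integrable_bound[OF g])
       (use f_le[OF that] f_nonneg in \<open>auto intro!: AE_I2 intro: order_trans[OF _ abs_ge_self]\<close>)
  \<comment> \<open>The shift by \<open>n0\<close> is made because domination by \<open>g\<close> is
    known only from \<open>n0\<close> on.\<close>
  have "(\<lambda>n. integral\<^sup>L lborel (f (n + n0))) \<longlonglongrightarrow>
     integral\<^sup>L lborel (\<lambda>u. c * (indicator {0<..} u * (u powr q * exp (- (u powr p)))))"
  proof (rule integral_dominated_convergence[where w = g])
    show "AE u in lborel. (\<lambda>n. f (n + n0) u) \<longlonglongrightarrow> c * (indicator {0<..} u * (u powr q * exp (- (u powr p))))"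
      using LIMSEQ_ignore_initial_segment[OF f_lim] by auto
    show "AE u in lborel. norm (f (n + n0) u) \<le> g u" for n
      using f_le[of "n + n0"] f_nonneg by auto
  qed (use g in auto)
  hence lim: "(\<lambda>n. integral\<^sup>L lborel (f n)) \<longlonglongrightarrow> c * Gamma ((q + 1) / p) / p"
    using has_bochner_integral_powr_exp_powr[OF p q]
    by (auto simp: has_bochner_integral_iff dest: LIMSEQ_offset)
  show ?thesis
  proof (rule that[of "\<lambda>n. integral\<^sup>L lborel (f n)"])
    show "\<forall>\<^sub>F n in sequentially. (\<Sum>k. ennreal ((1 - F (real k * d n)) ^ k * w n k)) =
            ennreal (N n * integral\<^sup>L lborel (f n))"
      using eventually_ge_at_top[of n0]
    proof eventually_elim
      case (elim n)
      have "(\<Sum>k. ennreal ((1 - F (real k * d n)) ^ k * w n k)) =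
          ennreal (N n) * (\<integral>\<^sup>+u. ennreal ((1 - F (real (nat \<lfloor>N n * u\<rfloor>) * d n)) ^ (nat \<lfloor>N n * u\<rfloor>) *
             w n (nat \<lfloor>N n * u\<rfloor>)) * indicator {0<..} u \<partial>lborel)"
        by (rule suminf_ennreal_eq_nn_integral) simp
      also have "(\<integral>\<^sup>+u. ennreal ((1 - F (real (nat \<lfloor>N n * u\<rfloor>) * d n)) ^ (nat \<lfloor>N n * u\<rfloor>) *
             w n (nat \<lfloor>N n * u\<rfloor>)) * indicator {0<..} u \<partial>lborel) = (\<integral>\<^sup>+u. ennreal (f n u) \<partial>lborel)"
        by (intro nn_integral_cong) (auto simp: f_def idx_def indicator_def)
      also have "\<dots> = ennreal (integral\<^sup>L lborel (f n))"
        using f_int[OF elim] f_nonneg by (intro nn_integral_eq_integral) auto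
      finally show ?case
        using f_nonneg N_pos[of n] by (simp add: ennreal_mult' order_less_imp_le)
    qed
    show "integral\<^sup>L lborel (f n) \<ge> 0" for n
      using f_nonneg by (intro integral_nonneg_AE) auto
  qed (use lim in \<open>auto simp: p_def\<close>)
qed

end

section \<open>Expectations under the prior\<close>

text \<open>Near 0 the density lies between \<open>(1 - \<epsilon>)\<close> and
  \<open>(1 + \<epsilon>)\<close> times the power law, and the kernel \<open>W y\<close> only sees
  points up to \<open>y\<close>, so integration preserves the two bounds. One kernel yields the
  asymptotics of \<open>F\<close>, another those of \<open>G\<close>.\<close>

lemma power_law_density_limit:
  fixes g V :: "real \<Rightarrow> real" and W :: "real \<Rightarrow> real \<Rightarrow> real"
  assumes g: "g \<sim>[at_right 0] (\<lambda>x. \<alpha> * x powr (\<beta> - 1))" and alpha: "\<alpha> > 0"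
    and W_nonneg: "\<And>x y. 0 \<le> W y x" and W_support: "\<And>x y. y < x \<Longrightarrow> W y x = 0"
    and W_integral: "\<And>y. y > 0 \<Longrightarrow> ((\<lambda>x. x powr (\<beta> - 1) * W y x) has_integral c * y powr q) {0..y}"
    and V_nonneg: "\<And>y. 0 \<le> V y"
    and V: "\<And>y. y > 0 \<Longrightarrow> ennreal (V y) = (\<integral>\<^sup>+x. (if 0 < x then ennreal (g x) else 0) * ennreal (W y x) \<partial>lborel)"
  shows "((\<lambda>y. V y / y powr q) \<longlongrightarrow> \<alpha> * c) (at_right 0)"
proof (rule tendstoI)
  fix e :: real assume e: "e > 0"
  have c: "c \<ge> 0"
    using has_integral_nonneg[OF W_integral[of 1]] W_nonneg by simp
  \<comment> \<open>The summand 1 keeps the divisor positive even if \<open>c = 0\<close>. Below,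
    \<open>\<epsilon> <= e / (2 z)\<close> makes the relative error at most \<open>e / 2\<close>,
    and \<open>\<epsilon> <= 1/2\<close> keeps \<open>1 - \<epsilon>\<close> positive.\<close>
  define z where "z = \<alpha> * c + 1"
  have z: "z \<ge> 1" using alpha c by (simp add: z_def)
  define \<epsilon> where "\<epsilon> = min (1/2) (e / (2 * z))"
  have eps: "\<epsilon> > 0" "\<epsilon> \<le> 1/2" "\<epsilon> \<le> e / (2 * z)"
    using e z by (auto simp: \<epsilon>_def)
  have "\<epsilon> * (\<alpha> * c) \<le> e / (2 * z) * z"
    using e alpha c eps z by (intro mult_mono) (auto simp: z_def)
  also have "\<dots> = e / 2" using z by simp
  finally have eps_e: "\<epsilon> * (\<alpha> * c) < e" using e by simp
  have "(\<lambda>x. g x - \<alpha> * x powr (\<beta> - 1)) \<in> o[at_right 0](\<lambda>x. \<alpha> * x powr (\<beta> - 1))"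
    using g by (simp add: asymp_equiv_altdef)
  from landau_o.smallD[OF this eps(1)]
  have "\<forall>\<^sub>F x in at_right 0. \<bar>g x - \<alpha> * x powr (\<beta> - 1)\<bar> \<le> \<epsilon> * (\<alpha> * x powr (\<beta> - 1))"
    using alpha by simp
  then obtain b where b: "b > 0"
    "\<And>x. 0 < x \<Longrightarrow> x < b \<Longrightarrow> \<bar>g x - \<alpha> * x powr (\<beta> - 1)\<bar> \<le> \<epsilon> * (\<alpha> * x powr (\<beta> - 1))"
    by (auto simp: eventually_at_right_field)
  have scaled: "(\<integral>\<^sup>+x. ennreal (indicator {0..y} x * (r * (x powr (\<beta> - 1) * W y x))) \<partial>lborel) =
                ennreal (r * (c * y powr q))" if "y > 0" "r \<ge> 0" for y r
    using that W_nonneg by (intro nn_integral_has_integral_lebesgue has_integral_mult_right W_integral) auto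
  have "dist (V y / y powr q) (\<alpha> * c) < e" if y: "0 < y" "y < b" for y
  proof -
    have "V y \<le> (1 + \<epsilon>) * \<alpha> * (c * y powr q)"
    proof -
      have "ennreal (V y) \<le> (\<integral>\<^sup>+x. ennreal (indicator {0..y} x * ((1 + \<epsilon>) * \<alpha> * (x powr (\<beta> - 1) * W y x))) \<partial>lborel)"
        unfolding V[OF y(1)]
      proof (intro nn_integral_mono)
        fix x :: real
        consider "x \<le> 0" | "x > y" | "0 < x" "x \<le> y" by linarith
        thus "(if 0 < x then ennreal (g x) else 0) * ennreal (W y x)
              \<le> ennreal (indicator {0..y} x * ((1 + \<epsilon>) * \<alpha> * (x powr (\<beta> - 1) * W y x)))"
        proof cases
          case 3
          have "g x \<le> (1 + \<epsilon>) * \<alpha> * x powr (\<beta> - 1)"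
            using b(2)[of x] 3 y by (simp add: algebra_simps abs_le_iff)
          hence "ennreal (g x) * ennreal (W y x) \<le> ennreal ((1 + \<epsilon>) * \<alpha> * x powr (\<beta> - 1)) * ennreal (W y x)"
            by (intro mult_right_mono ennreal_leI) auto
          also have "\<dots> = ennreal ((1 + \<epsilon>) * \<alpha> * x powr (\<beta> - 1) * W y x)"
            using eps alpha W_nonneg by (intro ennreal_mult[symmetric]) auto
          finally show ?thesis using 3 by (simp add: mult_ac)
        qed (use W_support in auto)
      qed
      also have "\<dots> = ennreal ((1 + \<epsilon>) * \<alpha> * (c * y powr q))"
        using scaled[OF y(1)] eps alpha by simp
      finally show ?thesis using eps alpha c by (simp add: ennreal_le_iff)
    qed
    moreover have "(1 - \<epsilon>) * \<alpha> * (c * y powr q) \<le> V y"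
    proof -
      have "ennreal ((1 - \<epsilon>) * \<alpha> * (c * y powr q)) =
            (\<integral>\<^sup>+x. ennreal (indicator {0..y} x * ((1 - \<epsilon>) * \<alpha> * (x powr (\<beta> - 1) * W y x))) \<partial>lborel)"
        using scaled[OF y(1)] eps alpha by simp
      also have "\<dots> \<le> ennreal (V y)"
        unfolding V[OF y(1)]
      proof (intro nn_integral_mono)
        fix x :: real
        consider "x \<le> 0" | "x > y" | "0 < x" "x \<le> y" by linarith
        thus "ennreal (indicator {0..y} x * ((1 - \<epsilon>) * \<alpha> * (x powr (\<beta> - 1) * W y x)))
              \<le> (if 0 < x then ennreal (g x) else 0) * ennreal (W y x)"
        proof cases
          case 1
          \<comment> \<open>The point 0 lies in the closed interval, but there
            \<open>0 powr (\<beta> - 1)\<close> is 0 by convention.\<close>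
          thus ?thesis by (cases "x = 0") auto
        next
          case 3
          have "(1 - \<epsilon>) * \<alpha> * x powr (\<beta> - 1) \<le> g x"
            using b(2)[of x] 3 y by (simp add: algebra_simps abs_le_iff)
          hence "ennreal ((1 - \<epsilon>) * \<alpha> * x powr (\<beta> - 1)) * ennreal (W y x) \<le> ennreal (g x) * ennreal (W y x)"
            by (intro mult_right_mono ennreal_leI) auto
          moreover have "ennreal ((1 - \<epsilon>) * \<alpha> * x powr (\<beta> - 1)) * ennreal (W y x) =
                         ennreal ((1 - \<epsilon>) * \<alpha> * x powr (\<beta> - 1) * W y x)"
            using eps alpha W_nonneg by (intro ennreal_mult[symmetric]) auto
          ultimately show ?thesis using 3 by (simp add: mult_ac)
        qed (use W_support in auto)
      qed
      finally show ?thesis using V_nonneg by (simp add: ennreal_le_iff)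
    qed
    ultimately have "\<bar>V y - \<alpha> * c * y powr q\<bar> \<le> \<epsilon> * (\<alpha> * c) * y powr q"
      by (simp add: algebra_simps abs_le_iff)
    also have "\<dots> < e * y powr q" using eps_e y by simp
    finally have "\<bar>V y - \<alpha> * c * y powr q\<bar> / y powr q < e" using y by (simp add: field_simps)
    also have "\<bar>V y - \<alpha> * c * y powr q\<bar> / y powr q = \<bar>(V y - \<alpha> * c * y powr q) / y powr q\<bar>"
      by simp
    also have "(V y - \<alpha> * c * y powr q) / y powr q = V y / y powr q - \<alpha> * c"
      using y by (simp add: diff_divide_distrib)
    finally show ?thesis by (simp add: dist_real_def)
  qed
  thus "\<forall>\<^sub>F y in at_right 0. dist (V y / y powr q) (\<alpha> * c) < e"
    using b(1) by (auto simp: eventually_at_right_field)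
qed

section \<open>Distribution of a single arm and independence of the arms\<close>

locale cbt_model = prob_space M for M :: "'a measure" +
  fixes mu :: "nat \<Rightarrow> 'a \<Rightarrow> real" and g :: "real \<Rightarrow> real" and \<alpha> \<beta> lam :: real
  assumes mu_dist: "\<And>i. 1 \<le> i \<Longrightarrow> distributed M lborel (mu i) (\<lambda>x. if 0 < x then ennreal (g x) else 0)"
    and mu_indep: "indep_vars (\<lambda>_. borel) mu {1..}"
    and alpha: "\<alpha> > 0" and beta: "\<beta> > 0" and lam: "lam > 0"
    and g_asymp: "g \<sim>[at_right 0] (\<lambda>x. \<alpha> * x powr (\<beta> - 1))"
begin

definition F :: "real \<Rightarrow> real" where "F y = prob {w \<in> space M. mu 1 w \<le> y}"

definition G :: "real \<Rightarrow> real" where "G y = enn2real (\<integral>\<^sup>+w. ennreal (max 0 (y - mu 1 w)) \<partial>M)"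

lemma mu_meas [measurable]: "1 \<le> i \<Longrightarrow> mu i \<in> borel_measurable M"
  using distributed_measurable[OF mu_dist] by simp

lemma mu_1_meas [measurable]: "mu 1 \<in> borel_measurable M" "mu (Suc i) \<in> borel_measurable M"
  by (rule mu_meas, simp)+

lemma nn_integral_mu:
  assumes "1 \<le> i" and h [measurable]: "h \<in> borel_measurable borel"
  shows "(\<integral>\<^sup>+w. h (mu i w) \<partial>M) = (\<integral>\<^sup>+x. (if 0 < x then ennreal (g x) else 0) * h x \<partial>lborel)"
  using distributed_nn_integral[OF mu_dist[OF assms(1)], of h] by simp

lemma nn_integral_mu_eq:
  assumes "1 \<le> i" "h \<in> borel_measurable borel"
  shows "(\<integral>\<^sup>+w. h (mu i w) \<partial>M) = (\<integral>\<^sup>+w. h (mu 1 w) \<partial>M)"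
  using assms nn_integral_mu by simp

lemma mu_pos: "1 \<le> i \<Longrightarrow> AE w in M. 0 < mu i w"
proof -
  assume i: "1 \<le> i"
  have "(\<integral>\<^sup>+w. indicator {..0} (mu i w) \<partial>M) =
        (\<integral>\<^sup>+x. (if 0 < x then ennreal (g x) else 0) * indicator {..0} x \<partial>lborel)"
    by (rule nn_integral_mu[OF i]) simp
  also have "\<dots> = (\<integral>\<^sup>+x. 0 \<partial>(lborel :: real measure))"
    by (intro nn_integral_cong) (auto simp: indicator_def)
  finally have "(\<integral>\<^sup>+w. indicator {..0} (mu i w) \<partial>M) = 0" by simp
  hence "AE w in M. indicator {..0} (mu i w) = (0::ennreal)"
    using i by (subst (asm) nn_integral_0_iff_AE) auto
  thus ?thesis by eventually_elim (auto simp: indicator_def split: if_splits)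
qed

lemma F_eq: "ennreal (F y) = (\<integral>\<^sup>+x. (if 0 < x then ennreal (g x) else 0) * ennreal (indicator {..y} x) \<partial>lborel)"
proof -
  have "ennreal (F y) = (\<integral>\<^sup>+w. indicator {w \<in> space M. mu 1 w \<le> y} w \<partial>M)"
    unfolding F_def by (simp add: emeasure_eq_measure)
  also have "\<dots> = (\<integral>\<^sup>+w. ennreal (indicator {..y} (mu 1 w)) \<partial>M)"
    by (intro nn_integral_cong) (auto simp: indicator_def)
  also have "\<dots> = (\<integral>\<^sup>+x. (if 0 < x then ennreal (g x) else 0) * ennreal (indicator {..y} x) \<partial>lborel)"
    by (rule nn_integral_mu) auto
  finally show ?thesis .
qed

lemma survival_eq:
  assumes "1 \<le> i"
  shows "(\<integral>\<^sup>+w. indicator {y<..} (mu i w) \<partial>M) = ennreal (1 - F y)"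
proof -
  have "(\<integral>\<^sup>+w. indicator {y<..} (mu i w) \<partial>M) = (\<integral>\<^sup>+w. indicator {y<..} (mu 1 w) \<partial>M)"
    by (rule nn_integral_mu_eq[OF assms]) simp
  also have "\<dots> = (\<integral>\<^sup>+w. indicator (space M - {w \<in> space M. mu 1 w \<le> y}) w \<partial>M)"
    by (intro nn_integral_cong) (auto simp: indicator_def)
  also have "\<dots> = ennreal (1 - F y)"
    unfolding F_def by (subst nn_integral_indicator) (auto simp: emeasure_eq_measure prob_compl)
  finally show ?thesis .
qed

lemma F_props: "mono F" "0 \<le> F x" "F x \<le> 1"
  unfolding F_def by (auto intro!: monoI finite_measure_mono)

text \<open>Arms are almost surely positive, so the integrand is bounded by \<open>max 0 y\<close>.
  The integral is therefore finite and \<open>enn2real\<close> in the definition of \<open>G\<close>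
  loses nothing.\<close>

lemma G_integral:
  shows "(\<integral>\<^sup>+w. ennreal (max 0 (y - mu 1 w)) \<partial>M) = ennreal (G y)"
    and G_nonneg: "0 \<le> G y" and G_le: "G y \<le> max 0 y"
proof -
  have "(\<integral>\<^sup>+w. ennreal (max 0 (y - mu 1 w)) \<partial>M) \<le> (\<integral>\<^sup>+w. ennreal (max 0 y) \<partial>M)"
    using mu_pos[of 1] by (intro nn_integral_mono_AE) (auto elim!: eventually_mono intro: ennreal_leI)
  hence *: "(\<integral>\<^sup>+w. ennreal (max 0 (y - mu 1 w)) \<partial>M) \<le> ennreal (max 0 y)"
    by (simp add: emeasure_space_1)
  show **: "(\<integral>\<^sup>+w. ennreal (max 0 (y - mu 1 w)) \<partial>M) = ennreal (G y)"
    unfolding G_def using * by (intro ennreal_enn2real[symmetric]) (auto simp: top_unique less_top intro: le_less_trans)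
  show "0 \<le> G y" by (simp add: G_def)
  show "G y \<le> max 0 y" using * unfolding ** by (subst (asm) ennreal_le_iff) auto
qed

lemma F_ratio: "((\<lambda>y. F y / y powr \<beta>) \<longlongrightarrow> \<alpha> / \<beta>) (at_right 0)"
proof -
  have "((\<lambda>y. F y / y powr \<beta>) \<longlongrightarrow> \<alpha> * (1 / \<beta>)) (at_right 0)"
  proof (rule power_law_density_limit[OF g_asymp alpha, where W = "\<lambda>y. indicator {..y}"])
    fix y :: real assume "y > 0"
    hence "((\<lambda>x. x powr (\<beta> - 1)) has_integral 1 / \<beta> * y powr \<beta>) {0..y}"
      using has_integral_powr_from_0[of "\<beta> - 1" y] beta by simp
    thus "((\<lambda>x. x powr (\<beta> - 1) * indicat_real {..y} x) has_integral 1 / \<beta> * y powr \<beta>) {0..y}"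
      by (rule has_integral_eq[rotated]) auto
  qed (use F_props F_eq in auto)
  thus ?thesis by simp
qed

lemma G_ratio: "((\<lambda>y. G y / y powr (\<beta> + 1)) \<longlongrightarrow> \<alpha> / (\<beta> * (\<beta> + 1))) (at_right 0)"
proof -
  have "((\<lambda>y. G y / y powr (\<beta> + 1)) \<longlongrightarrow> \<alpha> * (1 / (\<beta> * (\<beta> + 1)))) (at_right 0)"
  proof (rule power_law_density_limit[OF g_asymp alpha, where W = "\<lambda>y x. max 0 (y - x)"])
    fix y :: real assume y: "y > 0"
    have "((\<lambda>x. y * x powr (\<beta> - 1) - x powr \<beta>) has_integral
             y * (y powr \<beta> / \<beta>) - y powr (\<beta> + 1) / (\<beta> + 1)) {0..y}"
      using has_integral_powr_from_0[of "\<beta> - 1" y] has_integral_powr_from_0[of \<beta> y] beta y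
      by (intro has_integral_diff has_integral_mult_right) auto
    also have "y * (y powr \<beta> / \<beta>) - y powr (\<beta> + 1) / (\<beta> + 1) = 1 / (\<beta> * (\<beta> + 1)) * y powr (\<beta> + 1)"
      using y beta by (simp add: powr_add field_simps)
    finally show "((\<lambda>x. x powr (\<beta> - 1) * max 0 (y - x)) has_integral 1 / (\<beta> * (\<beta> + 1)) * y powr (\<beta> + 1)) {0..y}"
    proof (rule has_integral_eq[rotated])
      fix x assume x: "x \<in> {0..y}"
      show "y * x powr (\<beta> - 1) - x powr \<beta> = x powr (\<beta> - 1) * max 0 (y - x)"
        using x powr_add[of x "\<beta> - 1" 1] by (cases "x = 0") (auto simp: algebra_simps)
    qed
    show "ennreal (G y) = (\<integral>\<^sup>+x. (if 0 < x then ennreal (g x) else 0) * ennreal (max 0 (y - x)) \<partial>lborel)"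
      unfolding G_integral(1)[symmetric] by (rule nn_integral_mu) auto
  qed (use G_nonneg in auto)
  thus ?thesis by simp
qed

lemma nn_integral_survival_gap:
  "(\<integral>\<^sup>+w. (\<Prod>i\<in>{1..k}. indicator {y<..} (mu i w)) * ennreal (max 0 (y - mu (Suc k) w)) \<partial>M) =
   ennreal ((1 - F y) ^ k * G y)"
proof -
  \<comment> \<open>The survival factors and the shortfall of arm \<open>k + 1\<close> are merged
    into one family, so that the product rule for independent variables applies once.\<close>
  define Y where "Y i x = (if i \<le> k then indicator {y<..} x else ennreal (max 0 (y - x)))" for i and x :: real
  have "indep_vars (\<lambda>_. borel) (\<lambda>i w. Y i (mu i w)) {1..Suc k}"
    by (rule indep_vars_compose2[OF indep_vars_subset[OF mu_indep]]) (auto simp: Y_def)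
  hence "(\<integral>\<^sup>+w. (\<Prod>i\<in>{1..Suc k}. Y i (mu i w)) \<partial>M) = (\<Prod>i\<in>{1..Suc k}. \<integral>\<^sup>+w. Y i (mu i w) \<partial>M)"
    by (intro indep_vars_nn_integral) auto
  also have "(\<lambda>w. \<Prod>i\<in>{1..Suc k}. Y i (mu i w)) =
     (\<lambda>w. (\<Prod>i\<in>{1..k}. indicator {y<..} (mu i w)) * ennreal (max 0 (y - mu (Suc k) w)))"
    by (simp add: fun_eq_iff Y_def prod.nat_ivl_Suc')
  also have "(\<Prod>i\<in>{1..Suc k}. \<integral>\<^sup>+w. Y i (mu i w) \<partial>M) =
     (\<Prod>i\<in>{1..k}. \<integral>\<^sup>+w. indicator {y<..} (mu i w) \<partial>M) * (\<integral>\<^sup>+w. ennreal (max 0 (y - mu (Suc k) w)) \<partial>M)"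
    by (simp add: Y_def prod.nat_ivl_Suc' mult.commute)
  also have "(\<integral>\<^sup>+w. ennreal (max 0 (y - mu (Suc k) w)) \<partial>M) = ennreal (G y)"
    unfolding G_integral(1)[symmetric] by (rule nn_integral_mu_eq) auto
  also have "(\<Prod>i\<in>{1..k}. \<integral>\<^sup>+w. indicator {y<..} (mu i w) \<partial>M) = ennreal ((1 - F y) ^ k)"
    using F_props by (simp add: survival_eq ennreal_power)
  finally show ?thesis
    using F_props G_nonneg by (simp add: ennreal_mult)
qed

lemma nn_integral_survival:
  "(\<integral>\<^sup>+w. (\<Prod>i\<in>{1..k}. indicator {y<..} (mu i w)) \<partial>M) = ennreal ((1 - F y) ^ k)"
proof -
  have "indep_vars (\<lambda>_. borel) (\<lambda>i w. indicator {y<..} (mu i w) :: ennreal) {1..k}"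
    by (rule indep_vars_compose2[OF indep_vars_subset[OF mu_indep]]) auto
  hence "(\<integral>\<^sup>+w. (\<Prod>i\<in>{1..k}. indicator {y<..} (mu i w)) \<partial>M) =
         (\<Prod>i\<in>{1..k}. \<integral>\<^sup>+w. indicator {y<..} (mu i w) \<partial>M)"
    by (intro indep_vars_nn_integral) auto
  thus ?thesis
    using F_props by (simp add: survival_eq ennreal_power)
qed

section \<open>Measurability and exact series at a fixed horizon\<close>

context
  fixes n :: nat
  assumes n: "n > 0"
begin

lemma cbt_stop_meas [measurable]: "cbt_stop lam mu n \<in> M \<rightarrow>\<^sub>M count_space UNIV"
proof (rule measurable_count_space_eq2_countable[THEN iffD2], intro conjI allI ballI)
  fix k :: nat
  have less: "{w \<in> space M. j < cbt_stop lam mu n w} \<in> sets M" for j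
    unfolding less_cbt_stop_iff[OF lam n] by measurable
  have "cbt_stop lam mu n w \<noteq> 0" for w
    using cbt_stop_ge_1[OF lam n, of mu w] by linarith
  \<comment> \<open>Since \<open>K >= 1\<close>, the preimage of 0 is empty; it is separated because
    \<open>k - 1\<close> truncates at 0.\<close>
  hence "cbt_stop lam mu n -` {k} \<inter> space M =
      (if k = 0 then {} else {w \<in> space M. k - 1 < cbt_stop lam mu n w}) - {w \<in> space M. k < cbt_stop lam mu n w}"
    by (auto simp del: neq0_conv)
  thus "cbt_stop lam mu n -` {k} \<inter> space M \<in> sets M" using less by auto
qed auto

lemma cbt_best_meas [measurable]: "cbt_best lam mu n \<in> borel_measurable M"
proof -
  have "(\<lambda>w. Min ((\<lambda>i. mu i w) ` {1..k})) \<in> borel_measurable M" for k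
    by (intro borel_measurable_Min) auto
  from measurable_compose_countable[OF this cbt_stop_meas] show ?thesis
    by (simp add: cbt_best_def[abs_def])
qed

lemma cbt_gap_meas [measurable]: "cbt_gap lam mu n \<in> borel_measurable M"
proof -
  \<comment> \<open>Measurability of \<open>mu i\<close> is known for \<open>i >= 1\<close>.
    Replacing the index by \<open>max 1 k\<close> covers all \<open>k\<close>, and agrees with the
    gap because \<open>K >= 1\<close>.\<close>
  have "(\<lambda>w. max 0 ((real k - 1) * (lam / real n) - mu (max 1 k) w)) \<in> borel_measurable M" for k
    by measurable
  from measurable_compose_countable[OF this cbt_stop_meas]
  have "(\<lambda>w. max 0 ((real (cbt_stop lam mu n w) - 1) * (lam / real n) -
           mu (max 1 (cbt_stop lam mu n w)) w)) \<in> borel_measurable M" .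
  also have "(\<lambda>w. max 0 ((real (cbt_stop lam mu n w) - 1) * (lam / real n) -
           mu (max 1 (cbt_stop lam mu n w)) w)) = cbt_gap lam mu n"
    unfolding cbt_gap_def fun_eq_iff using cbt_stop_ge_1[OF lam n, of mu] by (simp only: max_absorb2) simp
  finally show ?thesis .
qed

lemma nn_integral_cbt_stop:
  "(\<integral>\<^sup>+w. ennreal (real (cbt_stop lam mu n w)) \<partial>M) = (\<Sum>k. ennreal ((1 - F (real k * (lam / real n))) ^ k))"
proof -
  have "(\<integral>\<^sup>+w. ennreal (real (cbt_stop lam mu n w)) \<partial>M) = (\<Sum>k. emeasure M {w \<in> space M. k < cbt_stop lam mu n w})"
    using nn_integral_nat_function[OF cbt_stop_meas] by (simp add: ennreal_of_nat_eq_real_of_nat)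
  moreover have "emeasure M {w \<in> space M. k < cbt_stop lam mu n w} = ennreal ((1 - F (real k * (lam / real n))) ^ k)" for k
  proof -
    have "{w \<in> space M. k < cbt_stop lam mu n w} \<in> sets M" by measurable
    hence "emeasure M {w \<in> space M. k < cbt_stop lam mu n w} =
          (\<integral>\<^sup>+w. indicator {w \<in> space M. k < cbt_stop lam mu n w} w \<partial>M)"
      by simp
    also have "\<dots> = (\<integral>\<^sup>+w. (\<Prod>i\<in>{1..k}. indicator {real k * (lam / real n)<..} (mu i w)) \<partial>M)"
      unfolding less_cbt_stop_iff[OF lam n]
      by (intro nn_integral_cong) (auto intro!: prod.neutral[symmetric] simp: indicator_def)
    finally show ?thesis unfolding nn_integral_survival .
  qed
  ultimately show ?thesis by simp
qed

lemma nn_integral_cbt_gap: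
  "(\<integral>\<^sup>+w. ennreal (cbt_gap lam mu n w) \<partial>M) =
   (\<Sum>k. ennreal ((1 - F (real k * (lam / real n))) ^ k * G (real k * (lam / real n))))"
  unfolding cbt_gap_eq_suminf[OF lam n] nn_integral_survival_gap[symmetric]
  by (rule nn_integral_suminf) (auto intro!: borel_measurable_times borel_measurable_prod_ennreal)

text \<open>Taking expectations in \<open>cbt_best_gap_bounds\<close> and multiplying by
  \<open>n\<close> places \<open>n\<close> times the expected best mean between
  \<open>lam * e - n * z - lam\<close> and \<open>lam * e - n * z\<close>; exploration adds another
  \<open>lam * e\<close>.\<close>

lemma cbt_regret_bounds:
  assumes stop: "(\<integral>\<^sup>+w. ennreal (real (cbt_stop lam mu n w)) \<partial>M) = ennreal e"
    and gap: "(\<integral>\<^sup>+w. ennreal (cbt_gap lam mu n w) \<partial>M) = ennreal z"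
    and nonneg: "e \<ge> 0" "z \<ge> 0"
  shows "cbt_regret M lam mu n \<in> {2 * lam * e - real n * z - lam..2 * lam * e - real n * z}"
proof -
  have gap_nonneg: "0 \<le> cbt_gap lam mu n w" for w by (simp add: cbt_gap_def)
  have K: "has_bochner_integral M (\<lambda>w. real (cbt_stop lam mu n w)) e"
    using stop nonneg by (intro has_bochner_integral_nn_integral) auto
  have Z: "has_bochner_integral M (cbt_gap lam mu n) z"
    using gap nonneg gap_nonneg by (intro has_bochner_integral_nn_integral) auto
  note int = integrable.intros[OF K] integrable.intros[OF Z]
  note bounds = cbt_best_gap_bounds[OF lam n, of mu]
  \<comment> \<open>The pathwise bounds give \<open>best <= K d\<close> and
    \<open>best >= - gap\<close>, which bounds the absolute value without using the sign of the
    arms.\<close>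
  have best: "integrable M (cbt_best lam mu n)"
  proof (rule Bochner_Integration.integrable_bound)
    show "integrable M (\<lambda>w. real (cbt_stop lam mu n w) * (lam / real n) + cbt_gap lam mu n w)"
      using int by auto
    show "AE w in M. norm (cbt_best lam mu n w) \<le>
            norm (real (cbt_stop lam mu n w) * (lam / real n) + cbt_gap lam mu n w)"
    proof (intro always_eventually allI)
      fix w
      have "0 \<le> (real (cbt_stop lam mu n w) - 1) * (lam / real n)"
        using cbt_stop_ge_1[OF lam n, of mu w] lam by (intro mult_nonneg_nonneg) auto
      thus "norm (cbt_best lam mu n w) \<le>
            norm (real (cbt_stop lam mu n w) * (lam / real n) + cbt_gap lam mu n w)"
        using bounds[of w] gap_nonneg[of w] by auto
    qed
  qed simp
  define b where "b = integral\<^sup>L M (cbt_best lam mu n)"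
  have sum: "integral\<^sup>L M (\<lambda>w. cbt_best lam mu n w + cbt_gap lam mu n w) = b + z"
    using best int Z by (simp add: b_def has_bochner_integral_integral_eq)
  have "integral\<^sup>L M (\<lambda>w. (real (cbt_stop lam mu n w) - 1) * (lam / real n)) \<le> b + z"
    unfolding sum[symmetric] using best int bounds by (intro integral_mono) auto
  moreover have "integral\<^sup>L M (\<lambda>w. (real (cbt_stop lam mu n w) - 1) * (lam / real n)) = (e - 1) * (lam / real n)"
    using int K by (simp add: has_bochner_integral_integral_eq prob_space)
  moreover have "b + z \<le> integral\<^sup>L M (\<lambda>w. real (cbt_stop lam mu n w) * (lam / real n))"
    unfolding sum[symmetric] using best int bounds by (intro integral_mono) auto
  moreover have "integral\<^sup>L M (\<lambda>w. real (cbt_stop lam mu n w) * (lam / real n)) = e * (lam / real n)"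
    using int K by (simp add: has_bochner_integral_integral_eq)
  ultimately have "(e - 1) * (lam / real n) \<le> b + z" "b + z \<le> e * (lam / real n)" by auto
  hence "real n * ((e - 1) * (lam / real n)) \<le> real n * (b + z)" "real n * (b + z) \<le> real n * (e * (lam / real n))"
    by (intro mult_left_mono; simp)+
  hence "(e - 1) * lam \<le> real n * b + real n * z" "real n * b + real n * z \<le> e * lam"
    using n by (simp_all add: distrib_left)
  moreover have "cbt_regret M lam mu n = lam * e + real n * b"
    unfolding cbt_regret_def b_def using K by (simp add: has_bochner_integral_integral_eq)
  ultimately show ?thesis by (simp add: algebra_simps)
qed

end

end

section \<open>Asymptotics of the regret\<close>

text \<open>The left side is \<open>lam * N\<close> at horizon \<open>x\<close>; comparing
  logarithms identifies it. The factor \<open>\<beta> + 1\<close> inside the first power on the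
  right cancels against the second power.\<close>

lemma lam_scale_eq:
  fixes \<alpha> \<beta> lam x :: real
  assumes "\<alpha> > 0" "\<beta> > 0" "lam > 0" "x > 0"
  shows "lam * (\<alpha> / \<beta> * (lam / x) powr \<beta>) powr (- 1 / (\<beta> + 1)) =
    (lam * \<beta> * (\<beta> + 1) / \<alpha>) powr (1 / (\<beta> + 1)) * (1 / (\<beta> + 1)) powr (1 / (\<beta> + 1)) * x powr (\<beta> / (\<beta> + 1))"
    (is "?l = ?r")
proof -
  have "ln ?l = ln lam - (ln \<alpha> - ln \<beta> + \<beta> * (ln lam - ln x)) / (\<beta> + 1)"
    using assms by (simp add: ln_mult ln_powr ln_div)
  also have "\<dots> = (ln lam + ln \<beta> + ln (\<beta> + 1) - ln \<alpha>) / (\<beta> + 1) + (- ln (\<beta> + 1)) / (\<beta> + 1) + \<beta> / (\<beta> + 1) * ln x"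
    using assms(2) by (simp add: divide_simps, simp add: algebra_simps)
  also have "\<dots> = ln ?r"
    using assms by (simp add: ln_mult ln_powr ln_div add_pos_pos)
  finally show ?thesis
    using assms by (subst (asm) ln_inj_iff) (auto simp: add_pos_pos)
qed

context cbt_model
begin

text \<open>Near 0 this follows from \<open>G_ratio\<close>. From \<open>b\<close> on,
  \<open>G y <= y = y powr (- \<beta>) * y powr (\<beta> + 1)\<close>, whose first factor is at most
  \<open>b powr (- \<beta>)\<close>. The global bound dominates the weight in the gap
  series.\<close>

lemma G_le_powr:
  obtains A where "A \<ge> 0" "\<And>y. 0 \<le> y \<Longrightarrow> G y \<le> A * y powr (\<beta> + 1)"
proof -
  define c where "c = \<alpha> / (\<beta> * (\<beta> + 1))"
  have c: "c > 0" using alpha beta by (simp add: c_def)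
  have "\<forall>\<^sub>F y in at_right 0. G y / y powr (\<beta> + 1) < c + 1"
    using order_tendstoD(2)[OF G_ratio, of "c + 1"] by (simp add: c_def)
  then obtain b where b: "b > 0" "\<And>y. 0 < y \<Longrightarrow> y < b \<Longrightarrow> G y / y powr (\<beta> + 1) < c + 1"
    by (auto simp: eventually_at_right_field)
  show ?thesis
  proof (rule that[of "c + 1 + b powr (- \<beta>)"])
    fix y :: real assume "0 \<le> y"
    then consider "y = 0" | "0 < y" "y < b" | "b \<le> y" by linarith
    thus "G y \<le> (c + 1 + b powr (- \<beta>)) * y powr (\<beta> + 1)"
    proof cases
      case 1
      thus ?thesis using G_le[of 0] by simp
    next
      case 2
      hence "G y \<le> (c + 1) * y powr (\<beta> + 1)" using b(2)[of y] by (simp add: field_simps)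
      also have "\<dots> \<le> (c + 1 + b powr (- \<beta>)) * y powr (\<beta> + 1)"
        by (intro mult_right_mono) auto
      finally show ?thesis .
    next
      case 3
      hence y: "y > 0" using b by simp
      have "G y \<le> y" using G_le[of y] y by simp
      also have "y = y powr (- \<beta>) * y powr (\<beta> + 1)" using y by (simp flip: powr_add)
      also have "\<dots> \<le> b powr (- \<beta>) * y powr (\<beta> + 1)"
        using 3 b beta by (intro mult_right_mono powr_mono2') auto
      also have "\<dots> \<le> (c + 1 + b powr (- \<beta>)) * y powr (\<beta> + 1)"
        using c by (intro mult_right_mono) auto
      finally show ?thesis .
    qed
  qed (use c in \<open>auto intro: add_nonneg_nonneg\<close>)
qed

text \<open>With \<open>p = \<beta> + 1\<close> and \<open>\<Gamma> = Gamma (1 + 1 / p)\<close>, the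
  rescaled expectation of \<open>K\<close> tends to \<open>\<Gamma>\<close> and that of the gap, in
  units of \<open>d\<close>, to \<open>\<Gamma> / p^2\<close>. The first enters twice, once for
  exploration and once through the best mean, and the second is subtracted.\<close>

lemma cbt_regret_scaled_lim:
  "(\<lambda>n. cbt_regret M lam mu n / (lam * (\<alpha> / \<beta> * (lam / real n) powr \<beta>) powr (- 1 / (\<beta> + 1))))
     \<longlonglongrightarrow> (2 - 1 / (\<beta> + 1)\<^sup>2) * Gamma (1 + 1 / (\<beta> + 1))"
proof -
  \<comment> \<open>The maximum keeps \<open>d 0\<close> positive, as the scaling locale asks for
    every index.\<close>
  define d where "d n = lam / real (max 1 n)" for n
  define p where "p = \<beta> + 1"
  have p: "p > 1" using beta by (simp add: p_def)
  have d_pos: "d n > 0" for n using lam by (simp add: d_def)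
  have "((\<lambda>x. lam / max 1 x) \<longlongrightarrow> 0) at_top" by real_asymp
  from filterlim_compose[OF this filterlim_real_sequentially] have d_lim: "d \<longlonglongrightarrow> 0"
    by (simp add: d_def[abs_def] of_nat_max)
  interpret S: cdf_scaling F \<beta> "\<alpha> / \<beta>" d
    by unfold_locales (use F_props F_ratio alpha beta d_pos d_lim in auto)
  obtain h where h: "h \<longlonglongrightarrow> 1 * Gamma ((0 + 1) / (\<beta> + 1)) / (\<beta> + 1)" "\<And>n. h n \<ge> 0"
    "\<forall>\<^sub>F n in sequentially. (\<Sum>k. ennreal ((1 - F (real k * d n)) ^ k * 1)) = ennreal (S.N n * h n)"
    by (rule S.weighted_survival_sum[of "\<lambda>_ _. 1" 1 1 0]) auto
  obtain A where A: "A \<ge> 0" "\<And>y. 0 \<le> y \<Longrightarrow> G y \<le> A * y powr (\<beta> + 1)"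
    using G_le_powr by blast
  \<comment> \<open>Dividing by \<open>d\<close> leaves \<open>k * (k d) powr \<beta>\<close>, which
    is of order one at stages of order \<open>N\<close>; hence the weight
    \<open>G (k d) / d\<close>.\<close>
  have powr_d: "(real k * d n) powr (\<beta> + 1) / d n = (real k / S.N n) powr (\<beta> + 1) / (\<alpha> / \<beta>)" for k n
    using d_pos[of n] by (subst S.scaled_powr[symmetric]) (cases "k = 0"; simp add: powr_add)
  obtain l where l: "l \<longlonglongrightarrow> 1 / p * Gamma (((\<beta> + 1) + 1) / (\<beta> + 1)) / (\<beta> + 1)" "\<And>n. l n \<ge> 0"
    "\<forall>\<^sub>F n in sequentially. (\<Sum>k. ennreal ((1 - F (real k * d n)) ^ k * (G (real k * d n) / d n))) = ennreal (S.N n * l n)"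
  proof (rule S.weighted_survival_sum[of "\<lambda>n k. G (real k * d n) / d n" "A / (\<alpha> / \<beta>)" "1 / p" "\<beta> + 1"])
    show "0 \<le> G (real k * d n) / d n" for n k using G_nonneg d_pos[of n] by simp
    show "G (real k * d n) / d n \<le> A / (\<alpha> / \<beta>) * (1 + (real k / S.N n) powr (\<beta> + 1))" for n k
    proof -
      have "G (real k * d n) / d n \<le> A * (real k * d n) powr (\<beta> + 1) / d n"
        using d_pos[of n] by (intro divide_right_mono A) auto
      also have "\<dots> = A / (\<alpha> / \<beta>) * (real k / S.N n) powr (\<beta> + 1)"
        unfolding times_divide_eq_right[symmetric] powr_d by simp
      also have "\<dots> \<le> A / (\<alpha> / \<beta>) * (1 + (real k / S.N n) powr (\<beta> + 1))"
        using A alpha beta by (intro mult_left_mono) auto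
      finally show ?thesis .
    qed
  next
    fix u :: real assume u: "u > 0"
    define x where "x n = real (S.idx n u) * d n" for n
    have x: "filterlim x (at_right 0) sequentially"
      unfolding x_def[abs_def] by (rule S.idx_d_at_right[OF u])
    have x_pos: "\<forall>\<^sub>F n in sequentially. x n > 0"
      using x by (auto simp: filterlim_at elim: eventually_mono)
    have "(\<lambda>n. G (x n) / x n powr (\<beta> + 1) * ((real (S.idx n u) / S.N n) powr (\<beta> + 1) / (\<alpha> / \<beta>)))
        \<longlonglongrightarrow> \<alpha> / (\<beta> * (\<beta> + 1)) * (u powr (\<beta> + 1) / (\<alpha> / \<beta>))"
      using u alpha beta
      by (intro tendsto_mult tendsto_divide tendsto_powr S.idx_div_N tendsto_const
            filterlim_compose[OF G_ratio x]) auto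
    moreover have "\<forall>\<^sub>F n in sequentially. G (x n) / x n powr (\<beta> + 1) *
        ((real (S.idx n u) / S.N n) powr (\<beta> + 1) / (\<alpha> / \<beta>)) = G (x n) / d n"
      using x_pos unfolding powr_d[symmetric] x_def[symmetric] by eventually_elim simp
    moreover have "\<alpha> / (\<beta> * (\<beta> + 1)) * (u powr (\<beta> + 1) / (\<alpha> / \<beta>)) = 1 / p * u powr (\<beta> + 1)"
      using alpha beta by (simp add: p_def)
    ultimately show "(\<lambda>n. G (real (S.idx n u) * d n) / d n) \<longlonglongrightarrow> 1 / p * u powr (\<beta> + 1)"
      unfolding x_def[symmetric] by (simp only: Lim_transform_eventually)
  qed (use beta in auto)
  define \<Gamma> where "\<Gamma> = Gamma (1 + 1 / p)"
  \<comment> \<open>The functional equation of Gamma brings both limits to multiples of the same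
    value.\<close>
  have "\<Gamma> = Gamma (1 / p) / p"
    using Gamma_plus1[of "1 / p"] nonpos_Ints_nonpos[of "1 / p"] p by (force simp: \<Gamma>_def add.commute)
  hence h_lim: "h \<longlonglongrightarrow> \<Gamma>" using h(1) by (simp add: p_def)
  have "(\<beta> + 1 + 1) / (\<beta> + 1) = 1 + 1 / p" using p by (simp add: p_def field_simps)
  hence l_lim: "l \<longlonglongrightarrow> \<Gamma> / p\<^sup>2"
    using l(1) by (simp add: \<Gamma>_def p_def power2_eq_square)
  \<comment> \<open>Since \<open>n d = lam\<close>, the gap contributes \<open>lam * N * l\<close>.
    The additive error \<open>lam\<close> becomes \<open>1 / N\<close> after division, which
    vanishes.\<close>
  have bounds: "\<forall>\<^sub>F n in sequentially. cbt_regret M lam mu n / (lam * S.N n) \<in> {2 * h n - l n - 1 / S.N n..2 * h n - l n}"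
    using h(3) l(3) eventually_gt_at_top[of 0]
  proof eventually_elim
    case (elim n)
    have dn: "d n = lam / real n" using elim(3) by (simp add: d_def)
    have "cbt_regret M lam mu n \<in>
       {2 * lam * (S.N n * h n) - real n * (d n * (S.N n * l n)) - lam..2 * lam * (S.N n * h n) - real n * (d n * (S.N n * l n))}"
    proof (rule cbt_regret_bounds[OF elim(3)])
      show "(\<integral>\<^sup>+w. ennreal (real (cbt_stop lam mu n w)) \<partial>M) = ennreal (S.N n * h n)"
        unfolding nn_integral_cbt_stop[OF elim(3)] using elim(1) by (simp add: dn)
      have "(\<integral>\<^sup>+w. ennreal (cbt_gap lam mu n w) \<partial>M) =
            (\<Sum>k. ennreal (d n) * ennreal ((1 - F (real k * d n)) ^ k * (G (real k * d n) / d n)))"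
        unfolding nn_integral_cbt_gap[OF elim(3)] dn[symmetric]
        using d_pos[of n] F_props G_nonneg by (simp flip: ennreal_mult)
      also have "\<dots> = ennreal (d n) * ennreal (S.N n * l n)"
        unfolding elim(2)[symmetric] by (rule ennreal_suminf_cmult)
      also have "\<dots> = ennreal (d n * (S.N n * l n))"
        using d_pos[of n] l(2) by (simp add: ennreal_mult)
      finally show "(\<integral>\<^sup>+w. ennreal (cbt_gap lam mu n w) \<partial>M) = ennreal (d n * (S.N n * l n))" .
    qed (use h(2) l(2) d_pos[of n] in auto)
    moreover have nd: "real n * (d n * (S.N n * l n)) = lam * S.N n * l n"
      using elim(3) by (simp add: dn)
    ultimately have "lam * S.N n * (2 * h n - l n - 1 / S.N n) \<le> cbt_regret M lam mu n"
      "cbt_regret M lam mu n \<le> lam * S.N n * (2 * h n - l n)"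
      unfolding nd by (simp_all add: algebra_simps)
    thus ?case using lam by (simp add: pos_divide_le_eq pos_le_divide_eq mult_ac)
  qed
  have "(\<lambda>n. cbt_regret M lam mu n / (lam * S.N n)) \<longlonglongrightarrow> 2 * \<Gamma> - \<Gamma> / p\<^sup>2"
  proof (rule tendsto_sandwich)
    have "(\<lambda>n. 1 / S.N n) \<longlonglongrightarrow> 0"
      by (rule tendsto_divide_0[OF tendsto_const filterlim_at_top_imp_at_infinity[OF S.N_at_top]])
    from tendsto_diff[OF tendsto_diff[OF tendsto_mult[OF tendsto_const h_lim] l_lim] this]
    show "(\<lambda>n. 2 * h n - l n - 1 / S.N n) \<longlonglongrightarrow> 2 * \<Gamma> - \<Gamma> / p\<^sup>2" by simp
    show "(\<lambda>n. 2 * h n - l n) \<longlonglongrightarrow> 2 * \<Gamma> - \<Gamma> / p\<^sup>2" by (intro tendsto_intros h_lim l_lim)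
  qed (use bounds in \<open>auto elim: eventually_mono\<close>)
  moreover have "\<forall>\<^sub>F n in sequentially. cbt_regret M lam mu n / (lam * S.N n) =
      cbt_regret M lam mu n / (lam * (\<alpha> / \<beta> * (lam / real n) powr \<beta>) powr (- 1 / (\<beta> + 1)))"
    using eventually_gt_at_top[of 0] by eventually_elim (simp add: S.N_def d_def max_def)
  moreover have "2 * \<Gamma> - \<Gamma> / p\<^sup>2 = (2 - 1 / (\<beta> + 1)\<^sup>2) * Gamma (1 + 1 / (\<beta> + 1))"
    by (simp add: \<Gamma>_def p_def algebra_simps)
  ultimately show ?thesis by (simp only: Lim_transform_eventually)
qed

end

theorem theorem2:
  fixes M :: "'a measure" and mu :: "nat \<Rightarrow> 'a \<Rightarrow> real" and g :: "real \<Rightarrow> real"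
    and alpha beta lam :: real
  assumes "prob_space M"
    and "\<And>x. 0 < x \<Longrightarrow> 0 \<le> g x"
    and "\<And>i. 1 \<le> i \<Longrightarrow>
           distributed M lborel (mu i) (\<lambda>x. if 0 < x then ennreal (g x) else 0)"
    and "prob_space.indep_vars M (\<lambda>_. borel) mu {1..}"
    and "alpha > 0" and "beta > 0" and "lam > 0"
    and "g \<sim>[at_right 0] (\<lambda>x. alpha * x powr (beta - 1))"
  shows "(\<lambda>n. cbt_regret M lam mu n) \<sim>[at_top]
           (\<lambda>n. (lam * beta * (beta + 1) / alpha) powr (1 / (beta + 1))
                 * ((1 / (beta + 1)) powr (1 / (beta + 1)) * (2 - 1 / (beta + 1)^2)
                    * Gamma (2 - beta / (beta + 1)))
                 * real n powr (beta / (beta + 1)))"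
    (is "_ \<sim>[at_top] ?T")
proof -
  interpret cbt_model M mu g alpha beta lam
    by (intro cbt_model.intro cbt_model_axioms.intro assms)
  \<comment> \<open>This is \<open>I_beta\<close> without its leading power, which
    \<open>lam_scale_eq\<close> assigns to the scale. Its positivity permits normalising the
    quotient to limit 1.\<close>
  define c where "c = (2 - 1 / (beta + 1)\<^sup>2) * Gamma (1 + 1 / (beta + 1))"
  have "1 < (beta + 1)\<^sup>2" using beta by (simp add: one_less_power)
  hence "1 / (beta + 1)\<^sup>2 < 1" by (subst divide_less_eq_1) auto
  moreover have "Gamma (1 + 1 / (beta + 1)) > 0" using beta by (intro Gamma_real_pos) (simp add: add_pos_pos)
  ultimately have c: "c > 0" unfolding c_def by (intro mult_pos_pos) auto
  have arg: "2 - beta / (beta + 1) = 1 + 1 / (beta + 1)" using beta by (simp add: field_simps)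
  have "(\<lambda>n. cbt_regret M lam mu n / (lam * (alpha / beta * (lam / real n) powr beta) powr (- 1 / (beta + 1))) / c)
          \<longlonglongrightarrow> c / c"
    using cbt_regret_scaled_lim c by (intro tendsto_divide tendsto_const) (auto simp: c_def)
  moreover have "\<forall>\<^sub>F n in sequentially.
      cbt_regret M lam mu n / (lam * (alpha / beta * (lam / real n) powr beta) powr (- 1 / (beta + 1))) / c =
      cbt_regret M lam mu n / ?T n"
    using eventually_gt_at_top[of 0]
    by eventually_elim (subst lam_scale_eq, use alpha beta lam in \<open>auto simp: arg c_def mult_ac\<close>)
  ultimately have "(\<lambda>n. cbt_regret M lam mu n / ?T n) \<longlonglongrightarrow> c / c"
    by (rule Lim_transform_eventually)
  hence "(\<lambda>n. cbt_regret M lam mu n / ?T n) \<longlonglongrightarrow> 1"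
    using c by simp
  thus ?thesis by (rule asymp_equivI')
qed

end
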